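(* Assume $l=d-1$ and $\Delta(x^0)\neq 0$. Then the iterated differential system described in the context consists of just one subsystem, of dimension $d$, namely $$y_1'(t_1)=v_1(y_1(t_1)),\qquad y_1(0)=x^0,$$ and it has the uniqueness property: any two solutions with values in $V$, defined on intervals containing $0$ in their interior, coincide on their common interval of definition.
   Context: Setting: $d\ge 2$, $1\le l\le d-1$ are integers, $\Omega\subset\mathbb{R}^d$ is a bounded domain, $x^0\in\Omega$, $F_1,\dots,F_l\in C^1(\Omega)$ are real valued and $F_j(x^0)=0$ for $j=1,\dots,l$. Let $A(x)=\left(\frac{\partial F_i}{\partial x_j}(x)\right)_{1\le i,j\le l}$ and $\Delta(x)=\det A(x)$. When $\Delta(x^0)\ne0$, $V\subset\Omega$ denotes an open neighbourhood of $x^0$ on which $\Delta\neq 0$. Vector fields: for $s=1,\dots,d-l$ and $x\in V$, $v_s(x)\in\mathbb{R}^d$ is the unique vector with $v_s(x)\cdot\nabla F_j(x)=0$ for $j=1,\dots,l$ whose last $d-l$ components are the $s$-th row of the identity matrix of $\mathbb{R}^{d-l}$ multiplied by $\Delta(x)$ (the $(l+s)$-th component is $\Delta(x)$ and the other components with index in $\{l+1,\dots,d\}$ are $0$). These fields are continuous on $V$. Iterated system: $\frac{\partial y_1}{\partial t_1}(t_1)=v_1(y_1(t_1))$, $y_1(0)=x^0$; and, for $j=2,\dots,d-l$, $\frac{\partial y_j}{\partial t_j}(t_1,\dots,t_j)=v_j(y_j(t_1,\dots,t_j))$, $y_j(t_1,\dots,t_{j-1},0)=y_{j-1}(t_1,\dots,t_{j-1})$,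 each subsystem being regarded as an ordinary differential system in $V$ in the variable $t_j$, with $t_1,\dots,t_{j-1}$ as parameters, on an interval containing $0$ in its interior. *)

theory Defs
  imports "HOL-Analysis.Analysis"
begin

text \<open>
  Points of \<open>\<real>\<^sup>d\<close> have type \<^typ>\<open>real ^ ('l + 'k)\<close>, where \<open>l = CARD('l)\<close> and \<open>d - l = CARD('k)\<close>:
  the coordinates \<open>x\<^sub>1, \<dots>, x\<^sub>l\<close> carry the indices \<open>Inl j\<close>, and \<open>x\<^sub>l\<^sub>+\<^sub>1, \<dots>, x\<^sub>d\<close> the indices \<open>Inr s\<close>.
  Since index types are nonempty, \<open>1 \<le> l \<le> d - 1\<close> and \<open>d \<ge> 2\<close> hold automatically.
\<close>

definition partial_deriv :: "'n::finite \<Rightarrow> (real ^ 'n \<Rightarrow> real) \<Rightarrow> real ^ 'n \<Rightarrow> real" where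
  "partial_deriv j f x = deriv (\<lambda>h. f (x + h *\<^sub>R axis j 1)) 0"

definition gradient :: "(real ^ 'n::finite \<Rightarrow> real) \<Rightarrow> real ^ 'n \<Rightarrow> real ^ 'n" where
  "gradient f x = (\<chi> j. partial_deriv j f x)"

definition C1_on :: "(real ^ 'n::finite) set \<Rightarrow> (real ^ 'n \<Rightarrow> real) \<Rightarrow> bool" where
  "C1_on \<Omega> f \<longleftrightarrow>
     (\<forall>x\<in>\<Omega>. f differentiable (at x)) \<and> (\<forall>j. continuous_on \<Omega> (partial_deriv j f))"

definition jac_matrix ::
  "('l::finite \<Rightarrow> real ^ ('l + 'k::finite) \<Rightarrow> real) \<Rightarrow> real ^ ('l + 'k) \<Rightarrow> real ^ 'l ^ 'l" where
  "jac_matrix F x = (\<chi> i j. partial_deriv (Inl j) (F i) x)"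

definition jac_det ::
  "('l::finite \<Rightarrow> real ^ ('l + 'k::finite) \<Rightarrow> real) \<Rightarrow> real ^ ('l + 'k) \<Rightarrow> real" where
  "jac_det F x = det (jac_matrix F x)"

text \<open>The description below determines a vector only where \<^term>\<open>jac_det F x \<noteq> 0\<close>.\<close>

definition tangent_field ::
  "('l::finite \<Rightarrow> real ^ ('l + 'k::finite) \<Rightarrow> real) \<Rightarrow> 'k \<Rightarrow> real ^ ('l + 'k) \<Rightarrow> real ^ ('l + 'k)" where
  "tangent_field F s x =
     (THE w. (\<forall>j. w \<bullet> gradient (F j) x = 0) \<and>
             (\<forall>r. w $ Inr r = (if r = s then jac_det F x else 0)))"

text \<open>At an endpoint belonging to the interval \<open>J\<close> the derivative is one-sided.\<close>

definition ivp_solution ::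
  "'a::real_normed_vector set \<Rightarrow> ('a \<Rightarrow> 'a) \<Rightarrow> 'a \<Rightarrow> real set \<Rightarrow> (real \<Rightarrow> 'a) \<Rightarrow> bool" where
  "ivp_solution V v p J y \<longleftrightarrow>
     is_interval J \<and> 0 \<in> interior J \<and> y 0 = p \<and>
     (\<forall>t\<in>J. y t \<in> V \<and> (y has_vector_derivative v (y t)) (at t within J))"

text \<open>
  A candidate solution of the iterated system is a pair \<open>(J, y)\<close>: the list
  \<open>[t\<^sub>1, \<dots>, t\<^sub>j]\<close> is the argument of \<^term>\<open>y j\<close>, and \<open>J [t\<^sub>1, \<dots>, t\<^sub>j\<^sub>-\<^sub>1]\<close> is the interval over which
  \<open>t\<^sub>j\<close> ranges for these values of the parameters.  A parameter list is admissible if each of its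
  entries lies in the interval belonging to the entries before it.
\<close>

definition admissible :: "(real list \<Rightarrow> real set) \<Rightarrow> real list \<Rightarrow> bool" where
  "admissible J ts \<longleftrightarrow> (\<forall>i<length ts. ts ! i \<in> J (take i ts))"

definition subsystem ::
  "(nat \<Rightarrow> 'a \<Rightarrow> 'a) \<Rightarrow> 'a::real_normed_vector set \<Rightarrow> 'a \<Rightarrow> nat \<Rightarrow>
   (real list \<Rightarrow> real set) \<Rightarrow> (nat \<Rightarrow> real list \<Rightarrow> 'a) \<Rightarrow> bool" where
  "subsystem v V x0 j J y \<longleftrightarrow>
     (\<forall>ts. length ts = j - 1 \<and> admissible J ts \<longrightarrow>
        ivp_solution V (v j) (if j = 1 then x0 else y (j - 1) ts) (J ts) (\<lambda>t. y j (ts @ [t])))"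

text \<open>
  The list of all subsystems, each given by its solution predicate.  The function \<open>e\<close> numbers the
  last \<open>d - l\<close> coordinates, so that \<open>v\<^sub>j\<close> is \<^term>\<open>tangent_field F (e j)\<close>.
\<close>

definition iterated_system ::
  "('l::finite \<Rightarrow> real ^ ('l + 'k::finite) \<Rightarrow> real) \<Rightarrow> (nat \<Rightarrow> 'k) \<Rightarrow>
   (real ^ ('l + 'k)) set \<Rightarrow> real ^ ('l + 'k) \<Rightarrow>
   ((real list \<Rightarrow> real set) \<Rightarrow> (nat \<Rightarrow> real list \<Rightarrow> real ^ ('l + 'k)) \<Rightarrow> bool) list" where
  "iterated_system F e V x0 =
     map (subsystem (\<lambda>j. tangent_field F (e j)) V x0) [1..<Suc CARD('k)]"

end

theory Submission
  imports Defs
begin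

text \<open>
  A solution stays in the level set of \<open>F\<close> through \<open>x\<^sup>0\<close>, which by the inverse function theorem is
  locally a curve parametrised by the last coordinate \<open>x\<^sub>d\<close>.  The system thus reduces locally to a
  scalar autonomous equation for \<open>x\<^sub>d\<close>, with right-hand side \<open>\<Delta>\<close> restricted to that curve.  This
  function is merely continuous, but it does not vanish, so separation of variables gives
  local uniqueness.  The set where two solutions agree is therefore both open and closed in the
  common interval.
\<close>

section \<open>Scalar autonomous equations with a continuous nonvanishing right-hand side\<close>

text \<open>By Rolle's theorem, a repeated value would force a zero of the derivative strictly
  between the two points.\<close>

lemma has_real_derivative_nonzero_imp_inj_on:
  fixes H :: "real \<Rightarrow> real"
  assumes H: "\<And>s. s \<in> {a..b} \<Longrightarrow> (H has_real_derivative h s) (at s within {a..b})"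
    and nz: "\<And>s. s \<in> {a..b} \<Longrightarrow> h s \<noteq> 0"
  shows "inj_on H {a..b}"
proof (rule linorder_inj_onI')
  fix u v assume uv: "u \<in> {a..b}" "v \<in> {a..b}" "u < v"
  show "H u \<noteq> H v"
  proof
    assume eq: "H u = H v"
    \<comment> \<open>Rolle's theorem asks for two-sided derivatives. Points strictly between
      \<open>u\<close> and \<open>v\<close> are interior to \<open>{a..b}\<close>, so the
      restriction of the filter disappears there.\<close>
    have der: "(H has_derivative (*) (h x)) (at x)" if "u < x" "x < v" for x
    proof -
      have "x \<in> interior {a..b}" using that uv by auto
      with H[of x] show ?thesis
        using at_within_interior[of x "{a..b}"] that uv by (auto simp: has_field_derivative_def)
    qed
    have "continuous_on {a..b} H"
      using H by (intro DERIV_continuous_on) auto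
    then have "continuous_on {u..v} H"
      by (rule continuous_on_subset) (use uv in auto)
    from Rolle_deriv[OF uv(3) eq this der] obtain w where w: "u < w" "w < v" "(*) (h w) = (\<lambda>v. 0)"
      by blast
    then have "h w = 0" by (metis mult.right_neutral)
    with nz[of w] w uv show False by auto
  qed
qed

text \<open>Separation of variables: if \<open>H\<close> is an antiderivative of
  \<open>1 / h\<close>, then \<open>H\<close> composed with any solution has derivative 1. Two
  solutions that meet at \<open>t0\<close> therefore have the same composition with
  \<open>H\<close>, and \<open>H\<close> is injective because its derivative never vanishes.\<close>

lemma autonomous_ode_unique_real:
  fixes u v h :: "real \<Rightarrow> real"
  assumes cont: "continuous_on {a..b} h" and nz: "\<And>s. s \<in> {a..b} \<Longrightarrow> h s \<noteq> 0"
    and T: "convex T" "t0 \<in> T" "u t0 = v t0"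
    and u: "\<And>t. t \<in> T \<Longrightarrow> u t \<in> {a..b} \<and> (u has_real_derivative h (u t)) (at t within T)"
    and v: "\<And>t. t \<in> T \<Longrightarrow> v t \<in> {a..b} \<and> (v has_real_derivative h (v t)) (at t within T)"
    and t: "t \<in> T"
  shows "u t = v t"
proof -
  have "continuous_on {a..b} (\<lambda>s. 1 / h s)"
    using cont nz by (intro continuous_intros) auto
  from antiderivative_continuous[OF this] obtain H where
    H: "\<And>s. s \<in> {a..b} \<Longrightarrow> (H has_real_derivative 1 / h s) (at s within {a..b})"
    unfolding has_real_derivative_iff_has_vector_derivative by metis
  have "inj_on H {a..b}"
    by (rule has_real_derivative_nonzero_imp_inj_on[OF H]) (use nz in auto)
  have der: "((\<lambda>t. H (w t)) has_real_derivative 1) (at t within T)"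
    if w: "\<And>t. t \<in> T \<Longrightarrow> w t \<in> {a..b} \<and> (w has_real_derivative h (w t)) (at t within T)"
      and t: "t \<in> T" for w t
  proof -
    \<comment> \<open>\<open>H\<close> is differentiable only within \<open>{a..b}\<close>, so the
      chain rule is applied relative to the image of \<open>T\<close>, which lies in that
      interval.\<close>
    have "(H has_real_derivative 1 / h (w t)) (at (w t) within w ` T)"
      using H w t by (blast intro: DERIV_subset)
    from DERIV_image_chain[OF this] w t have
      "(H \<circ> w has_real_derivative 1 / h (w t) * h (w t)) (at t within T)" by blast
    then show ?thesis using nz w t by (simp add: o_def)
  qed
  have "((\<lambda>t. H (u t) - H (v t)) has_derivative (\<lambda>h. 0)) (at t within T)" if "t \<in> T" for t
    using DERIV_diff[OF der[OF u that] der[OF v that]]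
    by (simp add: has_field_derivative_def lambda_zero)
  from has_derivative_zero_constant[OF T(1) this] obtain c where
    "\<And>t. t \<in> T \<Longrightarrow> H (u t) - H (v t) = c" by blast
  from this[OF t] this[OF T(2)] have "H (u t) = H (v t)" using T(3) by simp
  then show ?thesis using \<open>inj_on H {a..b}\<close> u v t by (auto dest: inj_onD)
qed

section \<open>Gradients as Frechet derivatives\<close>

text \<open>The operator \<open>deriv\<close> chooses some value; differentiability of
  \<open>f\<close> along the line through \<open>x\<close> in direction \<open>axis j 1\<close> pins
  that value down.\<close>

lemma partial_deriv_eq:
  assumes "(f has_derivative f') (at x)"
  shows "partial_deriv j f x = f' (axis j 1)"
proof -
  have "((\<lambda>h::real. x + h *\<^sub>R axis j 1) has_derivative (\<lambda>h. h *\<^sub>R axis j 1)) (at 0)"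
    by (auto intro!: derivative_eq_intros)
  moreover have "(f has_derivative f') (at (x + 0 *\<^sub>R axis j 1))" using assms by simp
  ultimately have "((\<lambda>h. f (x + h *\<^sub>R axis j 1)) has_derivative (\<lambda>h. f' (h *\<^sub>R axis j 1))) (at 0)"
    by (rule has_derivative_compose)
  moreover have "f' (h *\<^sub>R axis j 1) = f' (axis j 1) * h" for h
    using linear_scale[OF has_derivative_linear[OF assms]] by simp
  ultimately have "((\<lambda>h. f (x + h *\<^sub>R axis j 1)) has_field_derivative f' (axis j 1)) (at 0)"
    by (simp add: has_field_derivative_def)
  then show ?thesis unfolding partial_deriv_def by (rule DERIV_imp_deriv)
qed

lemma C1_on_has_derivative:
  assumes "C1_on \<Omega> f" "x \<in> \<Omega>"
  shows "(f has_derivative (\<lambda>h. h \<bullet> gradient f x)) (at x)"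
proof -
  obtain f' where f': "(f has_derivative f') (at x)"
    using assms unfolding C1_on_def differentiable_def by blast
  have lin: "linear f'" by (rule has_derivative_linear[OF f'])
  have "f' h = h \<bullet> gradient f x" for h
  proof -
    have "f' h = f' (\<Sum>j\<in>UNIV. h $ j *\<^sub>R axis j 1)"
      using basis_expansion[of h] by (simp add: scalar_mult_eq_scaleR)
    also have "\<dots> = (\<Sum>j\<in>UNIV. h $ j * partial_deriv j f x)"
      by (simp add: linear_sum[OF lin] linear_scale[OF lin] partial_deriv_eq[OF f'])
    finally show ?thesis by (simp add: gradient_def inner_vec_def)
  qed
  then have "f' = (\<lambda>h. h \<bullet> gradient f x)" by blast
  then show ?thesis using f' by simp
qed

section \<open>The straightening map and its derivative\<close>

text \<open>The map familiar from the implicit function theorem: keeping the last coordinates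
  completes \<open>F\<close> to a map between spaces of equal dimension. It carries level sets of
  \<open>F\<close> into affine subspaces on which the first coordinates are constant.\<close>

definition straighten ::
  "('l::finite \<Rightarrow> real ^ ('l + 'k::finite) \<Rightarrow> real) \<Rightarrow> real ^ ('l + 'k) \<Rightarrow> real ^ ('l + 'k)" where
  "straighten F x = (\<chi> i. case i of Inl j \<Rightarrow> F j x | Inr r \<Rightarrow> x $ Inr r)"

text \<open>Its matrix is block triangular, with diagonal blocks \<open>jac_matrix F x\<close> and
  the identity.\<close>

definition straighten_deriv ::
  "('l::finite \<Rightarrow> real ^ ('l + 'k::finite) \<Rightarrow> real) \<Rightarrow> real ^ ('l + 'k) \<Rightarrow>
   real ^ ('l + 'k) \<Rightarrow> real ^ ('l + 'k)" where
  "straighten_deriv F x h = (\<chi> i. case i of Inl j \<Rightarrow> h \<bullet> gradient (F j) x | Inr r \<Rightarrow> h $ Inr r)"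

lemma linear_straighten_deriv: "linear (straighten_deriv F x)"
  by (rule linearI)
     (auto simp: straighten_deriv_def vec_eq_iff inner_add_left split: sum.split)

lemma straighten_has_derivative:
  assumes "\<And>j. C1_on \<Omega> (F j)" "x \<in> \<Omega>"
  shows "(straighten F has_derivative straighten_deriv F x) (at x)"
proof (subst has_derivative_componentwise_within, clarify)
  fix b :: "real ^ ('a + 'b)" assume "b \<in> Basis"
  then obtain i where b: "b = axis i 1" by (auto simp: Basis_vec_def)
  have nth: "((\<lambda>x. x $ i) has_derivative (\<lambda>h. h $ i)) (at x)"
    by (intro bounded_linear_imp_has_derivative bounded_linear_vec_nth)
  show "((\<lambda>x. straighten F x \<bullet> b) has_derivative (\<lambda>h. straighten_deriv F x h \<bullet> b)) (at x)"
    using C1_on_has_derivative[OF assms(1,2)] nth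
    by (cases i) (auto simp: b inner_axis straighten_def straighten_deriv_def)
qed

lemma continuous_on_straighten_deriv:
  assumes "\<And>j. C1_on \<Omega> (F j)"
  shows "continuous_on \<Omega> (\<lambda>x. straighten_deriv F x h)"
proof -
  have "continuous_on \<Omega> (gradient (F j))" for j
    using assms[of j] unfolding gradient_def C1_on_def by (auto intro!: continuous_intros)
  then have "continuous_on \<Omega> (\<lambda>x. case i of Inl j \<Rightarrow> h \<bullet> gradient (F j) x | Inr r \<Rightarrow> h $ Inr r)" for i
    by (cases i) (auto intro!: continuous_intros)
  then show ?thesis unfolding straighten_deriv_def by (intro continuous_intros)
qed

lemma continuous_on_jac_det:
  assumes "\<And>j. C1_on \<Omega> (F j)"
  shows "continuous_on \<Omega> (jac_det F)"
proof -
  have "continuous_on \<Omega> (partial_deriv j (F i))" for i j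
    using assms by (simp add: C1_on_def)
  then show ?thesis
    unfolding jac_det_def[abs_def] det_def jac_matrix_def vec_lambda_beta
    by (intro continuous_on_sum continuous_on_mult continuous_on_const continuous_on_prod)
qed

text \<open>For a vector in the kernel, the identity block kills the last components; what remains
  is the equation that \<open>jac_matrix F x\<close> annihilates the first ones, and this matrix is
  invertible.\<close>

lemma inj_straighten_deriv:
  assumes "jac_det F x \<noteq> 0"
  shows "inj (straighten_deriv F x)"
proof (subst linear_injective_0[OF linear_straighten_deriv], intro allI impI)
  fix h assume "straighten_deriv F x h = 0"
  then have comp: "(case i of Inl j \<Rightarrow> h \<bullet> gradient (F j) x | Inr r \<Rightarrow> h $ Inr r) = 0" for i
    by (simp add: straighten_deriv_def vec_eq_iff)
  have Inr: "h $ Inr r = 0" for r using comp[of "Inr r"] by simp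
  have "jac_matrix F x *v (\<chi> j. h $ Inl j) = 0"
  proof (simp add: vec_eq_iff matrix_vector_mult_def jac_matrix_def, intro allI)
    fix j
    \<comment> \<open>Writing the index set as a disjoint sum separates the two blocks of
      coordinates; the \<open>Inr\<close> block contributes nothing.\<close>
    have "0 = (\<Sum>i\<in>UNIV <+> UNIV. h $ i * partial_deriv i (F j) x)"
      using comp[of "Inl j"] by (simp add: inner_vec_def gradient_def)
    also have "\<dots> = (\<Sum>i\<in>UNIV. h $ Inl i * partial_deriv (Inl i) (F j) x)"
      by (subst sum.Plus) (auto simp: Inr)
    finally show "(\<Sum>i\<in>UNIV. partial_deriv (Inl i) (F j) x * h $ Inl i) = 0"
      by (simp add: mult.commute)
  qed
  moreover have "invertible (jac_matrix F x)"
    using assms by (simp add: invertible_det_nz jac_det_def)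
  ultimately have "(\<chi> j. h $ Inl j) = 0"
    by (meson invertible_left_inverse matrix_left_invertible_ker)
  then have "h $ Inl j = 0" for j by (simp add: vec_eq_iff)
  with Inr show "h = 0" by (metis obj_sumE vec_eq_iff zero_index)
qed

section \<open>The tangent fields and their first integrals\<close>

text \<open>The conditions defining the field amount to one linear equation
  \<open>straighten_deriv F x w = q\<close>. An injective endomorphism in finite dimension is
  bijective, so the definite description denotes its unique solution.\<close>

lemma tangent_field_eqs:
  assumes "jac_det F x \<noteq> 0"
  shows "tangent_field F s x \<bullet> gradient (F j) x = 0"
    and "tangent_field F s x $ Inr r = (if r = s then jac_det F x else 0)"
proof -
  define P where "P w \<longleftrightarrow> (\<forall>j. w \<bullet> gradient (F j) x = 0) \<and>
             (\<forall>r. w $ Inr r = (if r = s then jac_det F x else 0))" for w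
  define q :: "real ^ ('a + 'b)" where
    "q = (\<chi> i. case i of Inl j \<Rightarrow> 0 | Inr r \<Rightarrow> if r = s then jac_det F x else 0)"
  have P: "P w \<longleftrightarrow> straighten_deriv F x w = q" for w
    unfolding P_def q_def straighten_deriv_def vec_eq_iff by (auto split: sum.splits)
  have inj: "inj (straighten_deriv F x)" by (rule inj_straighten_deriv[OF assms])
  then have "surj (straighten_deriv F x)"
    by (rule linear_inj_imp_surj[OF linear_straighten_deriv])
  then have "\<exists>!w. P w" unfolding P using inj by (metis injD surjD)
  then have "P (tangent_field F s x)"
    unfolding tangent_field_def P_def[symmetric] by (rule theI')
  then show "tangent_field F s x \<bullet> gradient (F j) x = 0"
    and "tangent_field F s x $ Inr r = (if r = s then jac_det F x else 0)"
    by (auto simp: P_def)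
qed

text \<open>By the chain rule, the derivative of \<open>F j\<close> along a solution is the inner
  product of the field with the gradient, which is zero; \<open>J\<close> is an interval, so the
  value at time 0 persists.\<close>

lemma tangent_field_first_integral:
  assumes C1: "C1_on \<Omega> (F j)" and V: "V \<subseteq> \<Omega>" "\<And>x. x \<in> V \<Longrightarrow> jac_det F x \<noteq> 0"
    and sol: "ivp_solution V (tangent_field F s) p J y" and t: "t \<in> J"
  shows "F j (y t) = F j p"
proof -
  have J: "convex J" "0 \<in> J" "y 0 = p"
    using sol interior_subset by (auto simp: ivp_solution_def is_interval_convex)
  have "((\<lambda>t. F j (y t)) has_derivative (\<lambda>h. 0)) (at t within J)" if "t \<in> J" for t
  proof -
    have yt: "y t \<in> V" "(y has_derivative (\<lambda>h. h *\<^sub>R tangent_field F s (y t))) (at t within J)"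
      using sol that by (auto simp: ivp_solution_def has_vector_derivative_def)
    have "(F j has_derivative (\<lambda>h. h \<bullet> gradient (F j) (y t))) (at (y t))"
      using C1 V yt by (blast intro: C1_on_has_derivative)
    from has_derivative_compose[OF yt(2) this] show ?thesis
      by (simp add: tangent_field_eqs(1)[OF V(2)[OF yt(1)]])
  qed
  from has_derivative_zero_constant[OF J(1) this] t J show ?thesis by metis
qed

section \<open>Local uniqueness\<close>

lemma straighten_local_inverse:
  fixes F :: "'l::finite \<Rightarrow> real ^ ('l + 'k::finite) \<Rightarrow> real"
  assumes C1: "\<And>j. C1_on V (F j)" and V: "open V" "p \<in> V" and nz: "jac_det F p \<noteq> 0"
  obtains U W g where "open U" "U \<subseteq> V" "p \<in> U" "open W" "homeomorphism U W (straighten F) g"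
proof -
  have bl: "bounded_linear (straighten_deriv F x)" for x
    by (simp add: linear_straighten_deriv linear_conv_bounded_linear[symmetric])
  \<comment> \<open>The inverse function theorem wants the derivative as a continuous family of
    bounded operators, together with a left inverse at \<open>p\<close>.\<close>
  define D where "D x = Blinfun (straighten_deriv F x)" for x
  have D: "blinfun_apply (D x) = straighten_deriv F x" for x
    by (simp add: D_def bounded_linear_Blinfun_apply bl)
  obtain g' where g': "linear g'" "g' \<circ> straighten_deriv F p = id"
    using linear_injective_left_inverse[OF linear_straighten_deriv inj_straighten_deriv[OF nz]]
    by blast
  have "Blinfun g' o\<^sub>L D p = id_blinfun"
    using g' by (intro blinfun_eqI)
      (simp add: D bounded_linear_Blinfun_apply linear_conv_bounded_linear pointfree_idE)
  \<comment> \<open>In finite dimension, continuity in the operator norm reduces to continuity of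
    \<open>D x h\<close> in \<open>x\<close> for fixed \<open>h\<close>.\<close>
  moreover have "continuous_on V D"
    by (rule continuous_on_blinfun_componentwise) (simp add: D continuous_on_straighten_deriv C1)
  moreover have "(straighten F has_derivative blinfun_apply (D x)) (at x)" if "x \<in> V" for x
    using straighten_has_derivative[OF C1 that] by (simp add: D)
  ultimately show ?thesis
    using V by (elim inverse_function_theorem[rotated 4]) (auto intro: that)
qed

text \<open>After straightening, both solutions run on one fixed line, so near \<open>t0\<close>
  each is recovered from its last coordinate, to which \<open>autonomous_ode_unique_real\<close>
  applies.\<close>

lemma tangent_field_solutions_agree_near:
  fixes F :: "'l::finite \<Rightarrow> real ^ ('l + 'k::finite) \<Rightarrow> real"
  assumes one: "CARD('k) = 1" and C1: "\<And>j. C1_on V (F j)"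
    and V: "open V" "\<And>x. x \<in> V \<Longrightarrow> jac_det F x \<noteq> 0"
    and y: "ivp_solution V (tangent_field F s) x0 J y"
    and z: "ivp_solution V (tangent_field F s) x0 K z"
    and t0: "t0 \<in> J \<inter> K" "y t0 = z t0"
  obtains \<epsilon> where "\<epsilon> > 0" "\<And>t. t \<in> J \<inter> K \<Longrightarrow> dist t t0 < \<epsilon> \<Longrightarrow> y t = z t"
proof -
  define S where "S = J \<inter> K"
  have S: "convex S" "t0 \<in> S"
    using y z t0 by (auto simp: S_def ivp_solution_def is_interval_convex convex_Int)
  \<comment> \<open>The type \<open>'k\<close> has a single element, so \<open>Inr s\<close> is the
    only coordinate outside the first block.\<close>
  have r: "r = s" for r :: 'k using one by (metis (full_types) UNIV_I card_1_singletonE singletonD)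
  have dy: "y t \<in> V" "(y has_vector_derivative tangent_field F s (y t)) (at t within S)" if "t \<in> S" for t
    using y that by (auto simp: ivp_solution_def S_def intro: has_vector_derivative_within_subset)
  have dz: "z t \<in> V" "(z has_vector_derivative tangent_field F s (z t)) (at t within S)" if "t \<in> S" for t
    using z that by (auto simp: ivp_solution_def S_def intro: has_vector_derivative_within_subset)
  define p where "p = y t0"
  have p: "p \<in> V" "z t0 = p" using dy(1)[OF S(2)] t0 by (simp_all add: p_def)
  obtain U W g where U: "open U" "U \<subseteq> V" "p \<in> U" and W: "open W"
    and hom: "homeomorphism U W (straighten F) g"
    using straighten_local_inverse[OF C1 V(1) p(1) V(2)[OF p(1)]] by metis
  \<comment> \<open>\<open>Q\<close> parametrises the line into which \<open>straighten F\<close>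
    sends the level set through \<open>x0\<close>.\<close>
  define Q :: "real \<Rightarrow> real ^ ('l + 'k)" where
    "Q u = (\<chi> i. case i of Inl j \<Rightarrow> F j x0 | Inr r \<Rightarrow> u)" for u
  have contQ: "continuous_on A Q" for A
  proof -
    have "continuous_on A (\<lambda>u. case i of Inl j \<Rightarrow> F j x0 | Inr r \<Rightarrow> u)" for i :: "'l + 'k"
      by (cases i) (auto intro!: continuous_intros)
    then show ?thesis unfolding Q_def by (intro continuous_intros)
  qed
  have Qy: "straighten F (y t) = Q (y t $ Inr s)" if "t \<in> S" for t
    using tangent_field_first_integral[OF C1 subset_refl V(2) y, of t] that r
    by (auto simp: straighten_def Q_def S_def vec_eq_iff split: sum.split) metis
  have Qz: "straighten F (z t) = Q (z t $ Inr s)" if "t \<in> S" for t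
    using tangent_field_first_integral[OF C1 subset_refl V(2) z, of t] that r
    by (auto simp: straighten_def Q_def S_def vec_eq_iff split: sum.split) metis
  have "open (Q -` W)" using W contQ by (simp add: open_vimage)
  moreover have "p $ Inr s \<in> Q -` W"
    using Qy[OF S(2)] homeomorphism_image1[OF hom] U(3) by (metis imageI p_def vimageI)
  \<comment> \<open>A closed interval is chosen because the antiderivative in the scalar lemma lives
    on \<open>{a..b}\<close>; over it \<open>Q\<close> stays in \<open>W\<close>, where
    \<open>g\<close> inverts \<open>straighten F\<close>.\<close>
  ultimately obtain \<delta> where \<delta>: "\<delta> > 0" "cball (p $ Inr s) \<delta> \<subseteq> Q -` W"
    using open_contains_cball by blast
  define a b where "a = p $ Inr s - \<delta>" and "b = p $ Inr s + \<delta>"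
  have ab: "cball (p $ Inr s) \<delta> = {a..b}" by (simp add: a_def b_def cball_eq_atLeastAtMost)
  \<comment> \<open>The right-hand side of the reduced equation: the determinant along the curve
    \<open>g (Q u)\<close>, which for \<open>u\<close> in \<open>{a..b}\<close> stays in
    \<open>V\<close>.\<close>
  define h where "h u = jac_det F (g (Q u))" for u
  have gQ: "g (Q u) \<in> V" if "u \<in> {a..b}" for u
  proof -
    have "Q u \<in> W" using that \<delta>(2) ab by auto
    then have "g (Q u) \<in> U" using homeomorphism_image2[OF hom] by blast
    then show ?thesis using U(2) by blast
  qed
  have "continuous_on {a..b} (\<lambda>u. g (Q u))"
    by (rule continuous_on_compose2[OF homeomorphism_cont2[OF hom] contQ])
      (use \<delta>(2)[unfolded ab] in \<open>simp add: image_subset_iff_subset_vimage\<close>)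
  then have conth: "continuous_on {a..b} h"
    unfolding h_def
    by (rule continuous_on_compose2[OF continuous_on_jac_det[OF C1]]) (use gQ in blast)
  \<comment> \<open>In \<open>N\<close> a point can be recovered by \<open>g\<close>, and its last
    coordinate lies in the domain of the reduced equation.\<close>
  define N where "N = U \<inter> {x. x $ Inr s \<in> ball (p $ Inr s) \<delta>}"
  have "open ((\<lambda>x::real^('l+'k). x $ Inr s) -` ball (p $ Inr s) \<delta>)"
    by (intro open_vimage open_ball continuous_on_component continuous_on_id)
  then have N: "open N" "p \<in> N" using U \<delta> by (auto simp: N_def vimage_def)
  have near: "\<exists>\<epsilon>>0. \<forall>t\<in>S. dist t t0 < \<epsilon> \<longrightarrow> w t \<in> N"
    if "w t0 = p" "continuous_on S w" for w :: "real \<Rightarrow> real ^ ('l + 'k)"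
  proof -
    obtain \<eta> where "\<eta> > 0" "ball p \<eta> \<subseteq> N" using N open_contains_ball by blast
    then show ?thesis using that S unfolding continuous_on_iff
      by (metis dist_commute mem_ball subsetD)
  qed
  have "continuous_on S y" "continuous_on S z"
    unfolding continuous_on_eq_continuous_within
    using dy(2) dz(2) has_vector_derivative_continuous by blast+
  with near p p_def obtain \<epsilon>1 \<epsilon>2 where e:
    "\<epsilon>1 > 0" "\<And>t. t \<in> S \<Longrightarrow> dist t t0 < \<epsilon>1 \<Longrightarrow> y t \<in> N"
    "\<epsilon>2 > 0" "\<And>t. t \<in> S \<Longrightarrow> dist t t0 < \<epsilon>2 \<Longrightarrow> z t \<in> N" by metis
  define \<epsilon> where "\<epsilon> = min \<epsilon>1 \<epsilon>2"
  define T where "T = S \<inter> ball t0 \<epsilon>"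
  have T: "convex T" "t0 \<in> T" "T \<subseteq> S" using S e by (auto simp: T_def \<epsilon>_def convex_Int)
  have yN: "y t \<in> N" and zN: "z t \<in> N" if "t \<in> T" for t
    using e that by (auto simp: T_def \<epsilon>_def dist_commute)
  \<comment> \<open>Since \<open>g (Q (w t $ Inr s)) = w t\<close>, the number
    \<open>h (w t $ Inr s)\<close> is the determinant at \<open>w t\<close>, hence the last
    component of the field there.\<close>
  have scalar: "w t $ Inr s \<in> {a..b} \<and>
      ((\<lambda>t. w t $ Inr s) has_real_derivative h (w t $ Inr s)) (at t within T)"
    if w: "w t \<in> N" "straighten F (w t) = Q (w t $ Inr s)"
      "(w has_vector_derivative tangent_field F s (w t)) (at t within S)"
    for w t
  proof
    show "w t $ Inr s \<in> {a..b}" using w(1) ab ball_subset_cball unfolding N_def by blast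
    have "w t \<in> U" using w by (auto simp: N_def)
    then have "h (w t $ Inr s) = jac_det F (w t)"
      using homeomorphism_apply1[OF hom, of "w t"] w(2) by (simp add: h_def)
    also have "\<dots> = tangent_field F s (w t) $ Inr s"
      using tangent_field_eqs(2)[OF V(2)[OF subsetD[OF U(2) \<open>w t \<in> U\<close>]]] by simp
    finally have "h (w t $ Inr s) = tangent_field F s (w t) $ Inr s" .
    moreover have "(w has_vector_derivative tangent_field F s (w t)) (at t within T)"
      using w(3) T(3) by (rule has_vector_derivative_within_subset)
    ultimately show "((\<lambda>t. w t $ Inr s) has_real_derivative h (w t $ Inr s)) (at t within T)"
      using bounded_linear.has_vector_derivative[OF bounded_linear_vec_nth]
      by (simp add: has_real_derivative_iff_has_vector_derivative)
  qed
  have "y t = z t" if "t \<in> T" for t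
  proof -
    have "y t $ Inr s = z t $ Inr s"
    proof (rule autonomous_ode_unique_real[OF conth _ T(1,2),
          where u = "\<lambda>t. y t $ Inr s" and v = "\<lambda>t. z t $ Inr s"])
      show "h u \<noteq> 0" if "u \<in> {a..b}" for u unfolding h_def by (rule V(2)[OF gQ[OF that]])
      show "y t0 $ Inr s = z t0 $ Inr s" using t0 by simp
    next
      fix t assume t: "t \<in> T"
      then have "t \<in> S" using T(3) by blast
      show "y t $ Inr s \<in> {a..b} \<and>
          ((\<lambda>t. y t $ Inr s) has_real_derivative h (y t $ Inr s)) (at t within T)"
        by (rule scalar[OF yN[OF t] Qy[OF \<open>t \<in> S\<close>] dy(2)[OF \<open>t \<in> S\<close>]])
      show "z t $ Inr s \<in> {a..b} \<and>
          ((\<lambda>t. z t $ Inr s) has_real_derivative h (z t $ Inr s)) (at t within T)"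
        by (rule scalar[OF zN[OF t] Qz[OF \<open>t \<in> S\<close>] dz(2)[OF \<open>t \<in> S\<close>]])
    qed (rule that)
    \<comment> \<open>Equal last coordinates give the same point of the line \<open>Q\<close>, and
      \<open>straighten F\<close> is injective on \<open>U\<close>.\<close>
    then have "straighten F (y t) = straighten F (z t)" using Qy Qz subsetD[OF T(3) that] by simp
    then show ?thesis
      using homeomorphism_apply1[OF hom] yN[OF that] zN[OF that] by (metis IntD1 N_def)
  qed
  moreover have "\<epsilon> > 0" using e by (simp add: \<epsilon>_def)
  ultimately show ?thesis using that by (auto simp: T_def S_def dist_commute)
qed

section \<open>Uniqueness on the whole common interval and the conclusion\<close>

lemma tangent_field_solutions_unique:
  fixes F :: "'l::finite \<Rightarrow> real ^ ('l + 'k::finite) \<Rightarrow> real"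
  assumes one: "CARD('k) = 1" and C1: "\<And>j. C1_on V (F j)"
    and V: "open V" "\<And>x. x \<in> V \<Longrightarrow> jac_det F x \<noteq> 0"
    and y: "ivp_solution V (tangent_field F s) x0 J y"
    and z: "ivp_solution V (tangent_field F s) x0 K z"
    and t: "t \<in> J \<inter> K"
  shows "y t = z t"
proof -
  define S where "S = J \<inter> K"
  define E where "E = {t \<in> S. y t = z t}"
  have S: "connected S" "0 \<in> S" "y 0 = z 0"
    using y z interior_subset
    by (auto simp: S_def ivp_solution_def is_interval_connected is_interval_Int)
  have "continuous_on J y" "continuous_on K z"
    using y z by (auto simp: ivp_solution_def intro: continuous_on_vector_derivative)
  then have "continuous_on S (\<lambda>t. y t - z t)"
    unfolding S_def by (intro continuous_intros) (auto intro: continuous_on_subset)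
  \<comment> \<open>Closedness and openness are relative to \<open>S\<close>, which may contain its
    endpoints.\<close>
  from continuous_closedin_preimage_constant[OF this, of 0]
  have "closedin (top_of_set S) E" by (simp add: E_def)
  moreover have "openin (top_of_set S) E"
    unfolding openin_euclidean_subtopology_iff
  proof (intro conjI ballI)
    fix t0 assume "t0 \<in> E"
    then have "t0 \<in> J \<inter> K" "y t0 = z t0" by (auto simp: E_def S_def)
    from tangent_field_solutions_agree_near[OF one C1 V y z this]
    show "\<exists>e>0. \<forall>x'\<in>S. dist x' t0 < e \<longrightarrow> x' \<in> E" unfolding E_def S_def
      by (metis (mono_tags, lifting) mem_Collect_eq)
  qed (auto simp: E_def)
  moreover have "0 \<in> E" using S by (simp add: E_def)
  ultimately have "E = S" using S(1) unfolding connected_clopen by blast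
  then show ?thesis using t by (auto simp: E_def S_def)
qed

theorem theorem1:
  fixes d l :: nat
    and \<Omega> V :: "(real ^ ('l::finite + 'k::finite)) set"
    and F :: "'l \<Rightarrow> real ^ ('l + 'k) \<Rightarrow> real"
    and x0 :: "real ^ ('l + 'k)"
    and e :: "nat \<Rightarrow> 'k"
  assumes d: "d = CARD('l + 'k)"
    and l: "l = CARD('l)"
    and e: "bij_betw e {1..d - l} (UNIV :: 'k set)"
    and domain: "open \<Omega>" "connected \<Omega>" "bounded \<Omega>" "x0 \<in> \<Omega>"
    and C1: "\<And>j. C1_on \<Omega> (F j)"
    and zero: "\<And>j. F j x0 = 0"
    and codim: "l = d - 1"
    and nonzero: "jac_det F x0 \<noteq> 0"
    and V: "open V" "x0 \<in> V" "V \<subseteq> \<Omega>" "\<And>x. x \<in> V \<Longrightarrow> jac_det F x \<noteq> 0"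
  shows "iterated_system F e V x0 =
           [\<lambda>J y. ivp_solution V (tangent_field F (e 1)) x0 (J []) (\<lambda>t. y 1 [t])] \<and>
         DIM(real ^ ('l + 'k)) = d \<and>
         (\<forall>J K y z. ivp_solution V (tangent_field F (e 1)) x0 J y \<and>
                    ivp_solution V (tangent_field F (e 1)) x0 K z \<longrightarrow>
                    (\<forall>t \<in> J \<inter> K. y t = z t))"
proof (intro conjI allI impI ballI)
  \<comment> \<open>The subtraction in \<open>codim\<close> is truncated; positive cardinalities
    exclude \<open>d = 0\<close>, and then \<open>CARD('k) = 1\<close> follows.\<close>
  have "d = l + CARD('k)" using d l by simp
  moreover have "0 < CARD('l)" "0 < CARD('k)" by (simp_all add: card_gt_0_iff)
  ultimately have one: "CARD('k) = 1" using codim l by linarith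
  \<comment> \<open>Only \<open>j = 1\<close> remains in the index list, and its sole parameter list
    is \<open>[]\<close>, which is vacuously admissible.\<close>
  then show "iterated_system F e V x0 =
           [\<lambda>J y. ivp_solution V (tangent_field F (e 1)) x0 (J []) (\<lambda>t. y 1 [t])]"
    by (auto simp: iterated_system_def subsystem_def admissible_def fun_eq_iff)
  show "DIM(real ^ ('l + 'k)) = d" using d by simp
  have "C1_on V (F j)" for j
    using C1[of j] V(3) unfolding C1_on_def by (blast intro: continuous_on_subset)
  then show "y t = z t"
    if "ivp_solution V (tangent_field F (e 1)) x0 J y \<and>
        ivp_solution V (tangent_field F (e 1)) x0 K z" and "t \<in> J \<inter> K" for J K y z t
    using tangent_field_solutions_unique[OF one _ V(1,4)] that by blast
qed

end
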